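(* Let $G$ be a graph (with nonempty vertex set) whose average degree $d = 2|E(G)|/|V(G)|$ satisfies $d \geq 2e$, where $e$ is the base of the natural logarithm. Then the correspondence chromatic number of $G$ satisfies $$\chi_c(G) \geq \frac{d/2}{\ln(d/2)}.$$
   Context: All graphs are finite, undirected, and simple. A cover of a graph $G$ is a pair $(L,H)$, where $L$ assigns pairwise disjoint sets $L(v)$ to the vertices $v \in V(G)$ and $H$ is a graph with vertex set $\bigcup_{v \in V(G)} L(v)$ such that: (1) if $xy \in E(H)$ with $x \in L(u)$, $y \in L(v)$, then $uv \in E(G)$ (in particular $u \neq v$); (2) for each $uv \in E(G)$, the edges of $H$ between $L(u)$ and $L(v)$ form a matching (not necessarily perfect, possibly empty). An $(L,H)$-coloring of $G$ is an independent set $I \subseteq V(H)$ in $H$ such that $I \cap L(v) \neq \emptyset$ for all $v \in V(G)$. $G$ is $(L,H)$-colorable if it admits an $(L,H)$-coloring. $G$ is $k$-correspondence-colorable if it is $(L,H)$-colorable for every cover $(L,H)$ of $G$ with $|L(v)| \geq k$ for all $v \in V(G)$. The correspondence chromatic number $\chi_c(G)$ is the least $k$ such that $G$ is $k$-correspondence-colorable. *)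

theory Defs
  imports Complex_Main "HOL-Library.Disjoint_Sets" "Graph_Theory.Pair_Digraph"
begin

text \<open>
  A finite simple undirected graph is a \<^const>\<open>pair_graph\<close>, i.e. a finite, loop-free, symmetric
  digraph without parallel arcs. Each undirected edge \<open>uv\<close> is represented by the two arcs
  \<open>(u, v)\<close> and \<open>(v, u)\<close>, so edges are counted via \<open>uedges\<close>, not via \<^const>\<open>parcs\<close>.
\<close>

definition uedges :: "'a pair_pre_digraph \<Rightarrow> 'a set set" where
  "uedges G = {{u, v} | u v. (u, v) \<in> parcs G}"

definition avg_degree :: "'a pair_pre_digraph \<Rightarrow> real" where
  "avg_degree G = 2 * real (card (uedges G)) / real (card (pverts G))"

definition uedges_between :: "'b pair_pre_digraph \<Rightarrow> 'b set \<Rightarrow> 'b set \<Rightarrow> 'b set set" where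
  "uedges_between H X Y = {{x, y} | x y. x \<in> X \<and> y \<in> Y \<and> (x, y) \<in> parcs H}"

definition matching :: "'b set set \<Rightarrow> bool" where
  "matching M \<longleftrightarrow> (\<forall>e\<in>M. \<forall>f\<in>M. e \<noteq> f \<longrightarrow> e \<inter> f = {})"

definition is_cover :: "'a pair_pre_digraph \<Rightarrow> ('a \<Rightarrow> 'b set) \<Rightarrow> 'b pair_pre_digraph \<Rightarrow> bool" where
  "is_cover G L H \<longleftrightarrow>
     disjoint_family_on L (pverts G) \<and>
     pair_graph H \<and>
     pverts H = (\<Union>v\<in>pverts G. L v) \<and>
     (\<forall>u\<in>pverts G. \<forall>v\<in>pverts G. \<forall>x\<in>L u. \<forall>y\<in>L v.
        (x, y) \<in> parcs H \<longrightarrow> (u, v) \<in> parcs G) \<and>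
     (\<forall>u v. (u, v) \<in> parcs G \<longrightarrow> matching (uedges_between H (L u) (L v)))"

definition independent_set :: "'b pair_pre_digraph \<Rightarrow> 'b set \<Rightarrow> bool" where
  "independent_set H I \<longleftrightarrow> I \<subseteq> pverts H \<and> (\<forall>x\<in>I. \<forall>y\<in>I. (x, y) \<notin> parcs H)"

definition is_cover_coloring ::
    "'a pair_pre_digraph \<Rightarrow> ('a \<Rightarrow> 'b set) \<Rightarrow> 'b pair_pre_digraph \<Rightarrow> 'b set \<Rightarrow> bool" where
  "is_cover_coloring G L H I \<longleftrightarrow>
     independent_set H I \<and> (\<forall>v\<in>pverts G. I \<inter> L v \<noteq> {})"

definition cover_colorable ::
    "'a pair_pre_digraph \<Rightarrow> ('a \<Rightarrow> 'b set) \<Rightarrow> 'b pair_pre_digraph \<Rightarrow> bool" where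
  "cover_colorable G L H \<longleftrightarrow> (\<exists>I. is_cover_coloring G L H I)"

text \<open>
  A definition cannot quantify over the type of the vertices of \<open>H\<close>. As \<open>H\<close> is finite, covers by
  graphs on natural numbers suffice; see \<open>correspondence_colorable_all_types\<close> below.
\<close>

definition correspondence_colorable :: "nat \<Rightarrow> 'a pair_pre_digraph \<Rightarrow> bool" where
  "correspondence_colorable k G \<longleftrightarrow>
     (\<forall>(L :: 'a \<Rightarrow> nat set) H. is_cover G L H \<and> (\<forall>v\<in>pverts G. k \<le> card (L v))
        \<longrightarrow> cover_colorable G L H)"

definition correspondence_chromatic_number :: "'a pair_pre_digraph \<Rightarrow> nat" where
  "correspondence_chromatic_number G = (LEAST k. correspondence_colorable k G)"

lemma correspondence_colorable_all_types:
  fixes L :: "'a \<Rightarrow> 'b set"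
  assumes col: "correspondence_colorable k G"
    and cov: "is_cover G L H"
    and k: "\<forall>v\<in>pverts G. k \<le> card (L v)"
  shows "cover_colorable G L H"
proof -
  have pg: "pair_graph H" and V: "pverts H = (\<Union>v\<in>pverts G. L v)"
    using cov by (auto simp: is_cover_def)
  interpret H: pair_graph H by (rule pg)
  obtain f :: "'b \<Rightarrow> nat" where f: "inj_on f (pverts H)"
    using finite_imp_inj_to_nat_seg[OF H.pair_finite_verts] by blast
  have LV: "L v \<subseteq> pverts H" if "v \<in> pverts G" for v using that V by blast
  define L' where "L' v = (if v \<in> pverts G then f ` L v else {})" for v
  define H' where "H' = \<lparr>pverts = f ` pverts H, parcs = map_prod f f ` parcs H\<rparr>"
  have arcs: "x \<in> pverts H \<and> y \<in> pverts H" if "(x, y) \<in> parcs H" for x y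
    using H.wellformed'[OF that] by simp
  have arc': "(f x, f y) \<in> parcs H' \<longleftrightarrow> (x, y) \<in> parcs H"
    if "x \<in> pverts H" "y \<in> pverts H" for x y
  proof
    assume "(f x, f y) \<in> parcs H'"
    then obtain a b where "(a, b) \<in> parcs H" "f a = f x" "f b = f y"
      by (auto simp: H'_def)
    then show "(x, y) \<in> parcs H" using that arcs f by (metis inj_onD)
  next
    assume "(x, y) \<in> parcs H"
    then show "(f x, f y) \<in> parcs H'" by (force simp: H'_def)
  qed
  have pg': "pair_graph H'"
  proof
    show "fst e \<in> pverts H'" "snd e \<in> pverts H'" if "e \<in> parcs H'" for e
      using that arcs by (auto simp: H'_def)
    show "finite (pverts H')" "finite (parcs H')" by (simp_all add: H'_def)
    have "(b, a) \<in> parcs H" if "(a, b) \<in> parcs H" for a b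
      using H.sym_arcs that unfolding symmetric_conv by fastforce
    then have "(b, a) \<in> parcs H'" if "(a, b) \<in> parcs H'" for a b
      using that by (force simp: H'_def)
    then show "symmetric (with_proj H')"
      by (force simp: symmetric_conv)
    show "fst e \<noteq> snd e" if "e \<in> parcs H'" for e
    proof -
      obtain x y where xy: "(x, y) \<in> parcs H" "e = (f x, f y)"
        using \<open>e \<in> parcs H'\<close> by (auto simp: H'_def)
      then have "x \<noteq> y" using H.no_loops' by blast
      then show ?thesis using xy arcs f by (auto dest: inj_onD)
    qed
  qed
  have "is_cover G L' H'"
    unfolding is_cover_def
  proof (intro conjI ballI allI impI pg')
    show "disjoint_family_on L' (pverts G)"
      unfolding disjoint_family_on_def
    proof (intro ballI impI)
      fix u v assume uv: "u \<in> pverts G" "v \<in> pverts G" "u \<noteq> v"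
      then have "L u \<inter> L v = {}" using cov by (auto simp: is_cover_def disjoint_family_on_def)
      then show "L' u \<inter> L' v = {}"
        using uv inj_on_image_Int[OF f LV LV, of u v] by (simp add: L'_def)
    qed
    show "pverts H' = (\<Union>v\<in>pverts G. L' v)" by (auto simp: H'_def L'_def V)
  next
    fix u v x y
    assume uv: "u \<in> pverts G" "v \<in> pverts G" and "x \<in> L' u" "y \<in> L' v" "(x, y) \<in> parcs H'"
    then obtain a b where "a \<in> L u" "b \<in> L v" "x = f a" "y = f b" by (auto simp: L'_def)
    then have "(a, b) \<in> parcs H" using arc' LV uv \<open>(x, y) \<in> parcs H'\<close> by blast
    then show "(u, v) \<in> parcs G"
      using cov uv \<open>a \<in> L u\<close> \<open>b \<in> L v\<close> unfolding is_cover_def by blast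
  next
    fix u v assume uv: "(u, v) \<in> parcs G"
    show "matching (uedges_between H' (L' u) (L' v))"
      unfolding matching_def
    proof (intro ballI impI)
      fix e e' assume e: "e \<in> uedges_between H' (L' u) (L' v)"
        "e' \<in> uedges_between H' (L' u) (L' v)" "e \<noteq> e'"
      have *: "\<exists>d\<in>uedges_between H (L u) (L v). d \<subseteq> pverts H \<and> c = f ` d"
        if c: "c \<in> uedges_between H' (L' u) (L' v)" for c
      proof -
        obtain x y where xy: "x \<in> L' u" "y \<in> L' v" "(x, y) \<in> parcs H'" "c = {x, y}"
          using c by (auto simp: uedges_between_def)
        then have uv': "u \<in> pverts G" "v \<in> pverts G" by (auto simp: L'_def split: if_splits)
        with xy obtain a b where ab: "a \<in> L u" "b \<in> L v" "x = f a" "y = f b"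
          by (auto simp: L'_def)
        then have "(a, b) \<in> parcs H" using arc' LV uv' xy by blast
        then have "{a, b} \<in> uedges_between H (L u) (L v)" "{a, b} \<subseteq> pverts H"
          using ab arcs by (auto simp: uedges_between_def)
        then show ?thesis using ab xy(4) by (intro bexI[of _ "{a, b}"]) auto
      qed
      obtain d d' where d: "d \<in> uedges_between H (L u) (L v)" "d' \<in> uedges_between H (L u) (L v)"
        "d \<subseteq> pverts H" "d' \<subseteq> pverts H" "e = f ` d" "e' = f ` d'"
        using *[OF e(1)] *[OF e(2)] by blast
      have "d \<noteq> d'" using d e(3) by blast
      moreover have "matching (uedges_between H (L u) (L v))"
        using cov uv unfolding is_cover_def by blast
      ultimately have "d \<inter> d' = {}" using d(1,2) unfolding matching_def by blast
      then show "e \<inter> e' = {}"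
        using inj_on_image_Int[OF f d(3,4)] d(5,6) by simp
    qed
  qed
  moreover have "\<forall>v\<in>pverts G. k \<le> card (L' v)"
    using k LV f by (simp add: L'_def card_image inj_on_subset)
  ultimately obtain I where I: "is_cover_coloring G L' H' I"
    using col unfolding correspondence_colorable_def cover_colorable_def by blast
  define J where "J = {x \<in> pverts H. f x \<in> I}"
  have "is_cover_coloring G L H J"
    unfolding is_cover_coloring_def independent_set_def
  proof (intro conjI ballI)
    show "J \<subseteq> pverts H" by (auto simp: J_def)
    show "(x, y) \<notin> parcs H" if "x \<in> J" "y \<in> J" for x y
      using that I arc' unfolding J_def is_cover_coloring_def independent_set_def by blast
    fix v assume v: "v \<in> pverts G"
    then obtain z where "z \<in> I" "z \<in> L' v" using I unfolding is_cover_coloring_def by blast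
    then obtain x where "x \<in> L v" "f x \<in> I" using v by (auto simp: L'_def)
    then show "J \<inter> L v \<noteq> {}" using LV[OF v] by (auto simp: J_def)
  qed
  then show ?thesis unfolding cover_colorable_def by blast
qed

text \<open>By a greedy choice of colours, the least \<open>k\<close> defining \<open>\<chi>\<^sub>c\<close> always exists.\<close>

lemma correspondence_colorable_card:
  assumes "pair_graph G"
  shows "correspondence_colorable (card (pverts G)) G"
  unfolding correspondence_colorable_def
proof (intro allI impI)
  fix L :: "'a \<Rightarrow> nat set" and H
  assume "is_cover G L H \<and> (\<forall>v\<in>pverts G. card (pverts G) \<le> card (L v))"
  then have cov: "is_cover G L H" and k: "\<And>v. v \<in> pverts G \<Longrightarrow> card (pverts G) \<le> card (L v)"
    by auto
  interpret G: pair_graph G by fact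
  interpret H: pair_graph H using cov by (simp add: is_cover_def)
  have V: "pverts H = (\<Union>v\<in>pverts G. L v)" using cov by (simp add: is_cover_def)
  have symH: "(y, x) \<in> parcs H" if "(x, y) \<in> parcs H" for x y
    using H.sym_arcs that unfolding symmetric_conv by fastforce
  have match: "y = y'"
    if "u \<in> pverts G" "v \<in> pverts G" "x \<in> L u" "y \<in> L v" "y' \<in> L v"
      "(x, y) \<in> parcs H" "(x, y') \<in> parcs H" for u v x y y'
  proof -
    have "(u, v) \<in> parcs G" using cov that unfolding is_cover_def by blast
    then have "matching (uedges_between H (L u) (L v))" using cov unfolding is_cover_def by blast
    moreover have "{x, y} \<in> uedges_between H (L u) (L v)" "{x, y'} \<in> uedges_between H (L u) (L v)"
      using that by (auto simp: uedges_between_def)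
    ultimately have "{x, y} = {x, y'}" unfolding matching_def by (metis disjoint_iff insertI1)
    then show ?thesis by (auto simp: doubleton_eq_iff)
  qed
  have "\<exists>c. (\<forall>v\<in>S. c v \<in> L v) \<and> (\<forall>u\<in>S. \<forall>v\<in>S. (c u, c v) \<notin> parcs H)"
    if "finite S" "S \<subseteq> pverts G" for S
    using that
  proof (induction S rule: finite_induct)
    case empty
    then show ?case by simp
  next
    case (insert w S)
    then obtain c where c: "\<forall>v\<in>S. c v \<in> L v" "\<forall>u\<in>S. \<forall>v\<in>S. (c u, c v) \<notin> parcs H" by blast
    define B where "B = (\<Union>u\<in>S. {y \<in> L w. (c u, y) \<in> parcs H})"
    have "card {y \<in> L w. (c u, y) \<in> parcs H} \<le> 1" if "u \<in> S" for u
    proof -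
      have cu: "c u \<in> L u" "u \<in> pverts G" "w \<in> pverts G"
        using c(1) that insert.prems by auto
      have fin: "finite {y \<in> L w. (c u, y) \<in> parcs H}"
        using H.pair_finite_verts by (rule rev_finite_subset) (use H.wellformed' in auto)
      show ?thesis
        unfolding One_nat_def card_le_Suc0_iff_eq[OF fin]
      proof (intro ballI)
        fix y y' assume "y \<in> {y \<in> L w. (c u, y) \<in> parcs H}" "y' \<in> {y \<in> L w. (c u, y) \<in> parcs H}"
        then have "y \<in> L w" "y' \<in> L w" "(c u, y) \<in> parcs H" "(c u, y') \<in> parcs H" by simp_all
        then show "y = y'" by (rule match[OF cu(2,3,1)])
      qed
    qed
    then have one: "(\<Sum>u\<in>S. card {y \<in> L w. (c u, y) \<in> parcs H}) \<le> (\<Sum>u\<in>S. 1)"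
      by (rule sum_mono)
    have "card B \<le> (\<Sum>u\<in>S. card {y \<in> L w. (c u, y) \<in> parcs H})"
      unfolding B_def by (rule card_UN_le[OF insert.hyps(1)])
    also have "\<dots> \<le> (\<Sum>u\<in>S. 1)" by (rule one)
    also have "\<dots> < card (insert w S)" using insert.hyps by simp
    also have "\<dots> \<le> card (pverts G)" by (rule card_mono) (use insert.prems in auto)
    also have "\<dots> \<le> card (L w)" using k insert.prems by simp
    finally have "\<not> L w \<subseteq> B"
    proof -
      assume a: "card B < card (L w)"
      have "finite (L w)"
        using H.pair_finite_verts by (rule rev_finite_subset) (use V insert.prems in auto)
      then have "finite B" by (rule rev_finite_subset) (auto simp: B_def)
      then show ?thesis using a card_mono[of B "L w"] by linarith
    qed
    then obtain y where y: "y \<in> L w" "y \<notin> B" by blast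
    have "(c u, y) \<notin> parcs H" "(y, c u) \<notin> parcs H" if "u \<in> S" for u
      using y that symH unfolding B_def by blast+
    moreover have "(y, y) \<notin> parcs H" using H.no_loops' by blast
    ultimately show ?case
      using c y(1) insert.hyps(2) by (intro exI[of _ "c(w := y)"]) auto
  qed
  then obtain c where c: "\<forall>v\<in>pverts G. c v \<in> L v"
    "\<forall>u\<in>pverts G. \<forall>v\<in>pverts G. (c u, c v) \<notin> parcs H"
    using G.pair_finite_verts by blast
  then have "is_cover_coloring G L H (c ` pverts G)"
    unfolding is_cover_coloring_def independent_set_def V by blast
  then show "cover_colorable G L H" unfolding cover_colorable_def by blast
qed

end

theory Submission
  imports Defs "HOL-Number_Theory.Cong"
begin

text \<open>
  Give every vertex the colours \<open>0, \<dots>, k - 1\<close> and every edge \<open>e\<close> a label \<open>s e < k\<close>, and forbid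
  the colours \<open>i, j\<close> on the ends of \<open>e\<close> whenever \<open>i + j \<equiv> s e\<close> modulo \<open>k\<close>. A fixed choice of colours
  survives exactly \<open>(k - 1)\<^sup>m\<close> of the \<open>k\<^sup>m\<close> labellings, so if each labelling admits one of the \<open>k\<^sup>n\<close>
  choices, then \<open>k\<^sup>m \<le> k\<^sup>n (k - 1)\<^sup>m\<close>. Taking logarithms gives \<open>m / n \<le> k ln k\<close>.
\<close>

definition label_cover :: "'a pair_pre_digraph \<Rightarrow> nat \<Rightarrow> ('a set \<Rightarrow> nat) \<Rightarrow> ('a \<times> nat) pair_pre_digraph" where
  "label_cover G k s = \<lparr>pverts = pverts G \<times> {..<k},
     parcs = {((u, i), (v, j)) | u i v j.
       (u, v) \<in> parcs G \<and> i < k \<and> j < k \<and> (i + j) mod k = s {u, v}}\<rparr>"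

lemma add_mod_left_cancel_less:
  fixes i j j' k :: nat
  assumes "(i + j) mod k = (i + j') mod k" "j < k" "j' < k"
  shows "j = j'"
  using assms by (metis cong_add_lcancel_nat cong_def mod_less)

text \<open>Since \<open>i + j\<close> is symmetric, labels on unordered edges give a symmetric arc
  relation. Modulo \<open>k\<close>, the colour at one end of an edge and the label determine the
  colour at the other end, so the conflicts form a matching.\<close>

lemma is_cover_label_cover:
  assumes "pair_graph G"
  shows "is_cover G (\<lambda>v. {v} \<times> {..<k}) (label_cover G k s)"
proof -
  interpret G: pair_graph G by fact
  have sym: "(v, u) \<in> parcs G" if "(u, v) \<in> parcs G" for u v
    using G.sym_arcs that unfolding symmetric_conv by fastforce
  have verts: "u \<in> pverts G \<and> v \<in> pverts G" if "(u, v) \<in> parcs G" for u v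
    using G.wellformed'[OF that] by simp
  have "pair_graph (label_cover G k s)"
  proof
    show "fst e \<in> pverts (label_cover G k s)" "snd e \<in> pverts (label_cover G k s)"
      if "e \<in> parcs (label_cover G k s)" for e
      using that verts by (auto simp: label_cover_def)
    show fin: "finite (pverts (label_cover G k s))"
      using G.pair_finite_verts by (simp add: label_cover_def)
    have "parcs (label_cover G k s) \<subseteq> pverts (label_cover G k s) \<times> pverts (label_cover G k s)"
      using verts by (auto simp: label_cover_def)
    then show "finite (parcs (label_cover G k s))"
      by (rule finite_subset[OF _ finite_cartesian_product[OF fin fin]])
    have "(y, x) \<in> parcs (label_cover G k s)" if "(x, y) \<in> parcs (label_cover G k s)" for x y
      using that sym by (auto simp: label_cover_def insert_commute add.commute)
    then show "symmetric (with_proj (label_cover G k s))"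
      by (force simp: symmetric_conv)
    show "fst e \<noteq> snd e" if "e \<in> parcs (label_cover G k s)" for e
      using that G.no_loops' by (auto simp: label_cover_def)
  qed
  moreover have "matching (uedges_between (label_cover G k s) ({u} \<times> {..<k}) ({v} \<times> {..<k}))"
    if uv: "(u, v) \<in> parcs G" for u v
    unfolding matching_def
  proof (intro ballI impI)
    have "u \<noteq> v" using uv G.no_loops' by blast
    fix e f
    assume e: "e \<in> uedges_between (label_cover G k s) ({u} \<times> {..<k}) ({v} \<times> {..<k})"
      and f: "f \<in> uedges_between (label_cover G k s) ({u} \<times> {..<k}) ({v} \<times> {..<k})"
      and "e \<noteq> f"
    obtain i j where ij: "e = {(u, i), (v, j)}" "i < k" "j < k" "(i + j) mod k = s {u, v}"
      using e by (auto simp: uedges_between_def label_cover_def)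
    obtain i' j' where ij': "f = {(u, i'), (v, j')}" "i' < k" "j' < k" "(i' + j') mod k = s {u, v}"
      using f by (auto simp: uedges_between_def label_cover_def)
    have "j = j'" if "i = i'"
      using add_mod_left_cancel_less[of i j k j'] ij ij' that by simp
    moreover have "i = i'" if "j = j'"
      using add_mod_left_cancel_less[of j i k i'] ij ij' that by (simp add: add.commute)
    ultimately have "i \<noteq> i'" "j \<noteq> j'" using \<open>e \<noteq> f\<close> ij(1) ij'(1) by auto
    then show "e \<inter> f = {}" using \<open>u \<noteq> v\<close> ij(1) ij'(1) by auto
  qed
  ultimately show ?thesis
    unfolding is_cover_def by (auto simp: label_cover_def disjoint_family_on_def)
qed

text \<open>Independence at an edge \<open>{u, v}\<close> says that \<open>c u + c v\<close> misses
  the label modulo \<open>k\<close>; as \<open>u\<close> and \<open>v\<close> differ,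
  \<open>sum c {u, v}\<close> is this sum. The choices are extensional functions so that they can be
  counted.\<close>

lemma label_cover_colorable_imp_avoiding:
  assumes "pair_graph G"
    and "cover_colorable G (\<lambda>v. {v} \<times> {..<k}) (label_cover G k s)"
  shows "\<exists>c \<in> pverts G \<rightarrow>\<^sub>E {..<k}. \<forall>e \<in> uedges G. s e \<noteq> sum c e mod k"
proof -
  interpret G: pair_graph G by fact
  obtain I where I: "is_cover_coloring G (\<lambda>v. {v} \<times> {..<k}) (label_cover G k s) I"
    using assms(2) unfolding cover_colorable_def by blast
  then have "\<forall>v\<in>pverts G. \<exists>i. i < k \<and> (v, i) \<in> I"
    unfolding is_cover_coloring_def by blast
  then obtain c where c: "\<forall>v\<in>pverts G. c v < k \<and> (v, c v) \<in> I" by metis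
  have "s e \<noteq> sum (restrict c (pverts G)) e mod k" if e: "e \<in> uedges G" for e
  proof
    assume eq: "s e = sum (restrict c (pverts G)) e mod k"
    obtain u v where uv: "(u, v) \<in> parcs G" "e = {u, v}"
      using e unfolding uedges_def by blast
    then have "u \<noteq> v" "u \<in> pverts G" "v \<in> pverts G"
      using G.no_loops' G.wellformed'[OF uv(1)] by auto
    then have "((u, c u), (v, c v)) \<in> parcs (label_cover G k s)"
      using uv eq c by (simp add: label_cover_def)
    then show False
      using I c \<open>u \<in> pverts G\<close> \<open>v \<in> pverts G\<close>
      unfolding is_cover_coloring_def independent_set_def by blast
  qed
  then show ?thesis
    using c by (intro bexI[of _ "restrict c (pverts G)"]) auto
qed

lemma finite_uedges:
  assumes "pair_graph G"
  shows "finite (uedges G)"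
proof -
  interpret G: pair_graph G by fact
  have "uedges G = (\<lambda>(u, v). {u, v}) ` parcs G"
    by (auto simp: uedges_def)
  then show ?thesis using G.pair_finite_arcs by simp
qed

text \<open>Union bound: \<open>?S c\<close> collects the labellings that the choice
  \<open>c\<close> survives, and colorability makes these sets cover all labellings.\<close>

lemma correspondence_colorable_counting:
  assumes "pair_graph G" and "correspondence_colorable k G" and "k > 0"
  shows "k ^ card (uedges G) \<le> k ^ card (pverts G) * (k - 1) ^ card (uedges G)"
proof -
  interpret G: pair_graph G by fact
  let ?C = "pverts G \<rightarrow>\<^sub>E {..<k}"
  let ?S = "\<lambda>c. \<Pi>\<^sub>E e\<in>uedges G. {..<k} - {sum c e mod k}"
  have fin: "finite (uedges G)" using assms(1) by (rule finite_uedges)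
  have finC: "finite ?C" using G.pair_finite_verts by (intro finite_PiE) auto
  have "uedges G \<rightarrow>\<^sub>E {..<k} \<subseteq> (\<Union>c\<in>?C. ?S c)"
  proof
    fix s assume s: "s \<in> uedges G \<rightarrow>\<^sub>E {..<k}"
    have "cover_colorable G (\<lambda>v. {v} \<times> {..<k}) (label_cover G k s)"
      \<comment> \<open>The cover has pairs as vertices, so colorability has to be transferred from
        covers on natural numbers.\<close>
      by (rule correspondence_colorable_all_types[OF assms(2) is_cover_label_cover[OF assms(1)]])
        (simp add: card_cartesian_product)
    then obtain c where "c \<in> ?C" "\<forall>e \<in> uedges G. s e \<noteq> sum c e mod k"
      using label_cover_colorable_imp_avoiding[OF assms(1)] by blast
    moreover have "s \<in> ?S c" using s calculation(2) by (auto simp: PiE_iff)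
    ultimately show "s \<in> (\<Union>c\<in>?C. ?S c)" by blast
  qed
  then have "card (uedges G \<rightarrow>\<^sub>E {..<k}) \<le> card (\<Union>c\<in>?C. ?S c)"
    by (rule card_mono[rotated]) (intro finite_UN_I finC finite_PiE fin, simp)
  also have "\<dots> \<le> (\<Sum>c\<in>?C. card (?S c))"
    by (rule card_UN_le[OF finC])
  \<comment> \<open>As \<open>k > 0\<close>, the excluded residue lies in \<open>{..<k}\<close>, so
    exactly \<open>k - 1\<close> labels remain on each edge.\<close>
  also have "\<dots> = (\<Sum>c\<in>?C. (k - 1) ^ card (uedges G))"
    using fin \<open>k > 0\<close> by (intro sum.cong refl) (simp add: card_PiE)
  finally show ?thesis
    using fin G.pair_finite_verts by (simp add: card_PiE)
qed

text \<open>Some vertex has an empty list and cannot be coloured. This supplies the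
  \<open>k > 0\<close> that the counting bound requires.\<close>

lemma not_correspondence_colorable_0:
  assumes "pair_graph G" and "pverts G \<noteq> {}"
  shows "\<not> correspondence_colorable 0 G"
proof
  assume "correspondence_colorable 0 G"
  then have "cover_colorable G (\<lambda>v. {v} \<times> {..<0}) (label_cover G 0 (\<lambda>_. 0))"
    by (rule correspondence_colorable_all_types[OF _ is_cover_label_cover[OF assms(1)]]) simp
  then show False
    using assms(2) by (auto simp: cover_colorable_def is_cover_coloring_def)
qed

lemma ratio_le_mult_ln_of_power_le:
  fixes k m n :: nat
  assumes "k ^ m \<le> k ^ n * (k - 1) ^ m" and "k > 0" "m > 0" "n > 0"
  shows "real m / real n \<le> real k * ln (real k)"
proof -
  \<comment> \<open>For \<open>k = 1\<close> the assumption would read \<open>1 \<le> 0\<close>,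
    because \<open>m > 0\<close>. Now \<open>ln (k - 1)\<close> is taken of a positive
    number.\<close>
  have "k \<noteq> 1" using assms by (auto simp: power_0_left)
  then have k: "k \<ge> 2" using \<open>k > 0\<close> by simp
  have "real k ^ m \<le> real k ^ n * (real k - 1) ^ m"
    using of_nat_mono[OF assms(1), where 'a = real] k by (simp add: of_nat_diff)
  then have "ln (real k ^ m) \<le> ln (real k ^ n * (real k - 1) ^ m)"
    using k by (subst ln_le_cancel_iff) auto
  then have le: "m * ln k \<le> n * ln k + m * ln (real k - 1)"
    using k by (simp add: ln_mult ln_realpow)
  \<comment> \<open>The inequality \<open>ln x \<le> x - 1\<close> at \<open>x = 1 - 1/k\<close>
    bounds the loss per edge, \<open>ln k - ln (k - 1)\<close>, below by \<open>1/k\<close>.\<close>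
  have "ln ((real k - 1) / k) \<le> (real k - 1) / k - 1"
    using k by (intro ln_le_minus_one) simp
  then have "1 / k \<le> ln k - ln (real k - 1)"
    using k ln_div[of "real k - 1" k] by (simp add: diff_divide_distrib)
  then have "m * (1 / k) \<le> m * (ln k - ln (real k - 1))"
    by (intro mult_left_mono) auto
  also have "\<dots> \<le> n * ln k" using le by (simp add: algebra_simps)
  finally show ?thesis using k \<open>n > 0\<close> by (simp add: field_simps)
qed

theorem theorem1p6:
  fixes G :: "'a pair_pre_digraph"
  assumes "pair_graph G"
    and "pverts G \<noteq> {}"
    and "avg_degree G \<ge> 2 * exp 1"
  shows "real (correspondence_chromatic_number G) \<ge>
           (avg_degree G / 2) / ln (avg_degree G / 2)"
proof -
  interpret G: pair_graph G by fact
  define k where "k = correspondence_chromatic_number G"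
  define D where "D = avg_degree G / 2"
  have D: "D = card (uedges G) / card (pverts G)"
    by (simp add: D_def avg_degree_def)
  have "D \<ge> exp 1" using assms(3) by (simp add: D_def)
  then have "D > 1" by (rule less_le_trans[rotated]) simp
  then have lnD: "ln D \<ge> 1" using \<open>D \<ge> exp 1\<close> by (simp add: ln_ge_iff)
  have n: "card (pverts G) > 0"
    using assms(2) G.pair_finite_verts by (simp add: card_gt_0_iff)
  have m: "card (uedges G) > 0"
    using \<open>D > 1\<close> by (auto simp: D intro: gr0I)
  have col: "correspondence_colorable k G"
    unfolding k_def correspondence_chromatic_number_def
    using correspondence_colorable_card[OF assms(1)] by (rule LeastI)
  then have "k > 0"
    using not_correspondence_colorable_0[OF assms(1,2)] by (auto intro: gr0I)
  then have le: "D \<le> k * ln k"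
    unfolding D using correspondence_colorable_counting[OF assms(1) col] m n
    by (intro ratio_le_mult_ln_of_power_le) auto
  have "D / ln D \<le> k"
  \<comment> \<open>If \<open>k \<le> D\<close>, then \<open>ln k\<close> may be replaced by
    \<open>ln D\<close> in \<open>D \<le> k * ln k\<close>. Otherwise \<open>k > D\<close>, and
    \<open>D \<ge> D / ln D\<close> because \<open>ln D \<ge> 1\<close>; this is where the bound
    \<open>d \<ge> 2e\<close> enters.\<close>
  proof (cases "real k \<le> D")
    case True
    then have "k * ln k \<le> k * ln D" using \<open>k > 0\<close> by (intro mult_left_mono) auto
    then show ?thesis using le lnD by (simp add: divide_le_eq)
  next
    case False
    have "D / ln D \<le> D / 1"
      using \<open>D > 1\<close> lnD by (intro divide_left_mono) auto
    then show ?thesis using False by simp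
  qed
  then show ?thesis by (simp add: k_def D_def)
qed

end
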